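(* For every integer $r\equiv1\pmod4$ with $r\ge9$, $\operatorname{pn}(\mathcal C_4(r))=r+1$.
   Context: $\mathcal C_4(r)$ is the directed Cayley digraph on $\mathbb Z_{4r}$ with arcs $x\to x+s$ for all $x\in\mathbb Z_{4r}$ and $s\in\{1,\ldots,r\}$. For a digraph $D$, the path number $\operatorname{pn}(D)$ is the minimum number of simple directed paths whose arc sets partition the arc set of $D$. *)

theory Defs
  imports "Graph_Theory.Digraph" "Graph_Theory.Arc_Walk" "HOL-Library.Disjoint_Sets"
begin

(* The Cayley digraph of the integers modulo n, represented by the residues 0, ..., n - 1,
   with connection set S.  Arcs are ordered pairs of vertices, so there are no parallel arcs. *)
definition cayley_cyclic :: "nat \<Rightarrow> nat set \<Rightarrow> (nat, nat \<times> nat) pre_digraph" where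
  "cayley_cyclic n S =
     \<lparr> verts = {0..<n},
       arcs = {(x, (x + s) mod n) | x s. x \<in> {0..<n} \<and> s \<in> S},
       tail = fst, head = snd \<rparr>"

definition C4 :: "nat \<Rightarrow> (nat, nat \<times> nat) pre_digraph" where
  "C4 r = cayley_cyclic (4 * r) {1..r}"

(* Since the blocks of a partition are nonempty and distinct, trivial (one-vertex) paths do
   not occur, and card P is the number of paths: in a path, the order of the arcs is
   determined by the arc set. *)
definition path_decomposition :: "('a, 'b) pre_digraph \<Rightarrow> 'b set set \<Rightarrow> bool" where
  "path_decomposition D P \<longleftrightarrow>
     finite P \<and> partition_on (arcs D) P \<and>
     (\<forall>A\<in>P. \<exists>u p v. pre_digraph.apath D u p v \<and> A = set p)"

(* Meaningful whenever a decomposition exists, in particular for all finite loopless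
   digraphs (path_decomposition_exists below). *)
definition path_number :: "('a, 'b) pre_digraph \<Rightarrow> nat" where
  "path_number D = (LEAST k. \<exists>P. path_decomposition D P \<and> card P = k)"

lemma path_decomposition_exists:
  assumes "loopfree_digraph D" and "finite (arcs D)"
  shows "\<exists>P. path_decomposition D P"
proof -
  interpret loopfree_digraph D by fact
  have "apath (tail D a) [a] (head D a)" if "a \<in> arcs D" for a
    using that no_loops by (auto simp: apath_def awalk_def)
  then have "\<exists>u p v. apath u p v \<and> {a} = set p" if "a \<in> arcs D" for a
    using that by (metis list.simps(15) set_empty2)
  then have "path_decomposition D ((\<lambda>a. {a}) ` arcs D)"
    using assms(2) by (auto simp: path_decomposition_def partition_on_def disjoint_def)
  then show ?thesis by blast
qed

lemma C4_loopfree: "loopfree_digraph (C4 r)"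
proof
  fix e assume e: "e \<in> arcs (C4 r)"
  then obtain x s where xs: "e = (x, (x + s) mod (4 * r))" "x < 4 * r" "1 \<le> s" "s \<le> r"
    by (auto simp: C4_def cayley_cyclic_def)
  then show "tail (C4 r) e \<in> verts (C4 r)" "head (C4 r) e \<in> verts (C4 r)"
    by (auto simp: C4_def cayley_cyclic_def)
  have "(x + s) mod (4 * r) \<noteq> x"
    using xs by (cases "x + s < 4 * r") (auto simp: mod_if)
  then show "tail (C4 r) e \<noteq> head (C4 r) e"
    using xs by (auto simp: C4_def cayley_cyclic_def)
qed

lemma C4_finite: "finite (arcs (C4 r))"
proof (rule finite_subset)
  show "arcs (C4 r) \<subseteq> {0..<4 * r} \<times> {0..<4 * r}"
    by (auto simp: C4_def cayley_cyclic_def)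
qed simp

end

theory Submission
  imports Defs "HOL-Number_Theory.Cong"
begin

text \<open>
  Every path has at most \<open>4r - 1\<close> arcs and there are \<open>4r\<^sup>2\<close> arcs, so \<open>r\<close> paths do not suffice.
  Conversely, let \<open>s\<close> assign to every residue modulo \<open>2r\<close> a step in \<open>{1..r}\<close>, such that every step is
  used once on the even and once on the odd residues and \<open>x \<mapsto> x + s(x)\<close> is a single cycle modulo \<open>2r\<close>.
  One turn of this cycle advances by \<open>r(r + 1)\<close>, which for \<open>r = 4k + 1\<close> is \<open>2r\<close> modulo \<open>4r\<close>, so the
  cycle lifts to a Hamiltonian cycle modulo \<open>4r\<close>.  Its translates by \<open>0, 2, \<dots>, 2(r - 1)\<close> partition the
  arcs.  Removing from the translates of the cycle the translates of one arc \<open>z \<rightarrow> z + 2\<close> leaves \<open>r\<close> paths,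
  and the removed arcs form one more path \<open>z, z + 2, \<dots>, z + 2r\<close>.
\<close>

section \<open>Paths in digraphs\<close>

text \<open>There is one more vertex than there are arcs; injectivity on the closed range
  \<open>{..m}\<close> includes the end vertex and makes the walk a simple path.\<close>

lemma (in pre_digraph) apath_map_upt:
  assumes "f 0 \<in> verts G"
    and "\<And>j. j < m \<Longrightarrow> a j \<in> arcs G"
    and "\<And>j. j < m \<Longrightarrow> tail G (a j) = f j"
    and "\<And>j. j < m \<Longrightarrow> head G (a j) = f (Suc j)"
    and "inj_on f {..m}"
  shows "apath (f 0) (map a [0..<m]) (f m)"
proof -
  have cas: "cas (f 0) (map a [0..<n]) (f n)" if "n \<le> m" for n
    using that
  proof (induction n)
    case (Suc n)
    have "awlast (f 0) (map a [0..<n]) = f n"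
      using Suc.prems by (cases n) (simp_all add: awalk_verts_conv assms)
    with Suc show ?case
      using assms(3,4) by simp
  qed simp
  have "awalk_verts (f 0) (map a [0..<m]) = map f [0..<Suc m]"
  proof (cases m)
    case (Suc n)
    then show ?thesis
      by (auto simp: awalk_verts_conv assms)
  qed simp
  moreover have "distinct (map f [0..<Suc m])"
    using assms(5) by (simp add: distinct_map atLeast0LessThan lessThan_Suc_atMost del: upt_Suc)
  ultimately show ?thesis
    using assms(1,2) cas[of m] by (auto simp: apath_def awalk_def)
qed

lemma (in wf_digraph) card_apath_less:
  assumes "apath u p v" "finite (verts G)"
  shows "card (set p) < card (verts G)"
proof -
  have "Suc (length p) = card (set (awalk_verts u p))"
    using assms(1) by (simp add: apath_def distinct_card length_awalk_verts)
  also have "\<dots> \<le> card (verts G)"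
    using assms by (intro card_mono) (auto simp: apath_def)
  finally show ?thesis
    using card_length[of p] by linarith
qed

section \<open>Decompositions from a cyclic step function\<close>

text \<open>If two of these iterates agreed, the orbit would become periodic and have fewer than
  \<open>card S\<close> points, too few to cover \<open>S\<close>.\<close>

lemma orbit_inj_on:
  fixes f :: "'a \<Rightarrow> 'a"
  assumes "S \<subseteq> range (\<lambda>j. (f ^^ j) x)"
  shows "inj_on (\<lambda>j. (f ^^ j) x) {..<card S}"
proof (rule ccontr)
  assume "\<not> ?thesis"
  then obtain a b where ab: "a < b" "b < card S" "(f ^^ a) x = (f ^^ b) x"
    by (auto simp: inj_on_def) (metis linorder_neqE_nat)
  have "(f ^^ j) x \<in> (\<lambda>j. (f ^^ j) x) ` {..<b}" for j
  proof (induction j rule: less_induct)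
    case (less j)
    show ?case
    proof (cases "j < b")
      case False
      have "(f ^^ j) x = (f ^^ (j - b)) ((f ^^ b) x)"
        using False by (metis funpow_add comp_apply le_add_diff_inverse2 not_less)
      also have "\<dots> = (f ^^ (j - b + a)) x"
        by (simp add: ab(3)[symmetric] funpow_add)
      finally show ?thesis
        using less[of "j - b + a"] False ab(1) by simp
    qed auto
  qed
  then have "S \<subseteq> (\<lambda>j. (f ^^ j) x) ` {..<b}"
    using assms by auto
  then have "card S \<le> b"
    by (metis card_image_le card_lessThan card_mono finite_imageI finite_lessThan le_trans)
  with ab(2) show False by simp
qed

text \<open>Row \<open>i\<close> will index the \<open>i\<close>-th translate of the Hamiltonian
  cycle, and column \<open>m\<close> the arc removed from each translate.\<close>

lemma partition_on_rows_and_last_column: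
  fixes m n :: nat
  assumes "0 < n" "0 < m"
  shows "partition_on ({..<n} \<times> {..<Suc m}) (insert ({..<n} \<times> {m}) ((\<lambda>i. {i} \<times> {..<m}) ` {..<n}))"
    (is "partition_on _ ?Q")
proof (rule partition_onI)
  show "\<Union> ?Q = {..<n} \<times> {..<Suc m}"
    by (auto simp: less_Suc_eq)
  show "disjnt p q" if "p \<in> ?Q" "q \<in> ?Q" "p \<noteq> q" for p q
    using that by (elim insertE imageE) (auto simp: disjnt_def)
  have "p \<noteq> {}" if "p \<in> ?Q" for p
    using that assms by (elim insertE imageE) (auto simp: lessThan_empty_iff)
  then show "{} \<notin> ?Q" by blast
qed

lemma card_rows_and_last_column:
  fixes m n :: nat
  assumes "0 < n" "0 < m"
  shows "card (insert ({..<n} \<times> {m}) ((\<lambda>i. {i} \<times> {..<m}) ` {..<n})) = n + 1"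
proof -
  have "inj_on (\<lambda>i. {i} \<times> {..<m}) {..<n}"
    using assms(2) by (intro inj_onI) (auto simp: times_eq_iff)
  moreover have "(0, m) \<in> {..<n} \<times> {m}" "(0, m) \<notin> {i} \<times> {..<m}" for i
    using assms by auto
  then have "{..<n} \<times> {m} \<notin> (\<lambda>i. {i} \<times> {..<m}) ` {..<n}"
    by blast
  ultimately show ?thesis
    by (simp add: card_image)
qed

text \<open>With this bound, injectivity of \<open>walk_arc\<close> will force it to hit every
  arc.\<close>

lemma card_arcs_C4_le: "card (arcs (C4 n)) \<le> 4 * n * n"
proof -
  have "{(x, g x s) | x s. x \<in> A \<and> s \<in> B} = (\<lambda>(x, s). (x, g x s)) ` (A \<times> B)"
    for g :: "nat \<Rightarrow> nat \<Rightarrow> nat" and A B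
    by auto
  then have "arcs (C4 n) = (\<lambda>(x, s). (x, (x + s) mod (4 * n))) ` ({0..<4 * n} \<times> {1..n})"
    unfolding C4_def cayley_cyclic_def pre_digraph.select_convs .
  then show ?thesis
    using card_image_le[of "{0..<4 * n} \<times> {1..n}" "\<lambda>(x, s). (x, (x + s) mod (4 * n))"]
    by (simp add: card_cartesian_product)
qed

text \<open>By \<open>st_inj\<close> and the bounds, each parity class uses every step once. The
  predecessor \<open>z\<close> of the start has step 2, the offset between consecutive translates,
  so that the removed arcs link up.\<close>

locale cyclic_step =
  fixes r :: nat and st :: "nat \<Rightarrow> nat" and x0 z :: nat
  assumes r_mod_4: "r mod 4 = 1"
    and st_ge: "x < 2 * r \<Longrightarrow> 1 \<le> st x"
    and st_le: "x < 2 * r \<Longrightarrow> st x \<le> r"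
    and st_inj: "\<lbrakk>x < 2 * r; y < 2 * r; x mod 2 = y mod 2; st x = st y\<rbrakk> \<Longrightarrow> x = y"
    and st_orbit: "x < 2 * r \<Longrightarrow> x \<in> range (\<lambda>j. ((\<lambda>x. (x + st x) mod (2 * r)) ^^ j) x0)"
    and x0: "x0 < 2 * r"
    and z: "z < 2 * r" "st z = 2" "(z + 2) mod (2 * r) = x0"
begin

section \<open>The cycle modulo 2r and its lift modulo 4r\<close>

lemma r_pos: "r > 0"
  using r_mod_4 by (cases r) auto

text \<open>Not reduced modulo \<open>4r\<close>, so that the length of one turn is a plain sum.\<close>

primrec walk :: "nat \<Rightarrow> nat" where
  "walk 0 = x0"
| "walk (Suc j) = walk j + st (walk j mod (2 * r))"

lemma walk_mod: "walk j mod (2 * r) = ((\<lambda>x. (x + st x) mod (2 * r)) ^^ j) x0"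
proof (induction j)
  case (Suc j)
  then show ?case
    by (simp add: mod_add_left_eq[of "walk j", symmetric])
qed (simp add: x0)

lemma walk_bij: "bij_betw (\<lambda>j. walk j mod (2 * r)) {..<2 * r} {..<2 * r}"
proof -
  have "inj_on (\<lambda>j. walk j mod (2 * r)) {..<2 * r}"
    using orbit_inj_on[of "{..<2 * r}" "\<lambda>x. (x + st x) mod (2 * r)" x0] st_orbit
    by (auto simp: walk_mod)
  moreover have "(\<lambda>j. walk j mod (2 * r)) ` {..<2 * r} \<subseteq> {..<2 * r}"
    using r_pos by auto
  ultimately show ?thesis
    by (simp add: bij_betw_def endo_inj_surj)
qed

text \<open>Pairing parity with step is injective between sets of size \<open>2 * r\<close>, so each
  step occurs exactly twice.\<close>

lemma sum_st: "(\<Sum>x<2 * r. st x) = r * (r + 1)"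
proof -
  let ?g = "\<lambda>x. (x mod 2, st x)"
  have inj: "inj_on ?g {..<2 * r}"
    using st_inj by (auto intro!: inj_onI)
  have "?g ` {..<2 * r} \<subseteq> {..<2} \<times> {1..r}"
    using st_ge st_le by fastforce
  moreover have "card (?g ` {..<2 * r}) = card ({..<2::nat} \<times> {1..r})"
    using card_image[OF inj] by (simp add: card_cartesian_product)
  ultimately have "?g ` {..<2 * r} = {..<2} \<times> {1..r}"
    by (intro card_subset_eq) auto
  then have "(\<Sum>x<2 * r. st x) = (\<Sum>(p, s)\<in>{..<2::nat} \<times> {1..r}. s)"
    using sum.reindex[OF inj, of snd] by (simp add: case_prod_unfold comp_def)
  also have "\<dots> = 2 * (\<Sum>s\<in>{1..r}. s)"
    by (simp flip: sum.cartesian_product)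
  also have "\<dots> = r * (r + 1)"
    using gauss_sum_from_Suc_0[of r, where 'a = nat] by simp
  finally show ?thesis .
qed

lemma walk_eq_sum: "walk n = x0 + (\<Sum>j<n. st (walk j mod (2 * r)))"
  by (induction n) simp_all

lemma walk_shift: "walk (j + 2 * r) = walk j + r * (r + 1)"
proof (induction j)
  case 0
  have "(\<Sum>j<2 * r. st (walk j mod (2 * r))) = (\<Sum>x<2 * r. st x)"
    by (rule sum.reindex_bij_betw[OF walk_bij])
  then show ?case
    by (simp add: walk_eq_sum[of "2 * r"] sum_st)
next
  case (Suc j)
  \<comment> \<open>Evenness makes \<open>r * (r + 1)\<close> a multiple of \<open>2 * r\<close>, so
    the next turn repeats the same steps.\<close>
  have "even (r + 1)"
    using r_mod_4 by presburger
  then obtain h where "r + 1 = 2 * h" by (elim evenE)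
  then have "r * (r + 1) = 2 * r * h" by simp
  then have "(walk j + r * (r + 1)) mod (2 * r) = walk j mod (2 * r)" by simp
  with Suc show ?case by simp
qed

text \<open>For odd \<open>r\<close>, half of \<open>r + 1\<close> is odd exactly when
  \<open>r mod 4 = 1\<close>; only then is a turn a shift by \<open>2 * r\<close> rather than by 0
  modulo \<open>4 * r\<close>.\<close>

lemma walk_shift_cong: "[walk (j + 2 * r) = walk j + 2 * r] (mod 4 * r)"
proof -
  obtain k where "r = 4 * k + 1"
    using r_mod_4 by (metis mult_div_mod_eq)
  then have "walk j + r * (r + 1) = walk j + 2 * r + 4 * r * k"
    by (simp add: algebra_simps)
  then show ?thesis
    by (simp only: walk_shift cong_def mod_mult_self2)
qed

text \<open>The second turn repeats the residues modulo \<open>2 * r\<close> of the first, but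
  shifted by \<open>2 * r\<close> modulo \<open>4 * r\<close>, so the two turns are
  disjoint.\<close>

lemma walk_inj: "inj_on (\<lambda>j. walk j mod (4 * r)) {..<4 * r}"
proof -
  have inj2: "i = j" if "[walk i = walk j] (mod 2 * r)" "i < 2 * r" "j < 2 * r" for i j
    using inj_onD[OF bij_betw_imp_inj_on[OF walk_bij], of i j] that by (simp add: cong_def)
  have *: "i = j" if "[walk i = walk j] (mod 4 * r)" "i \<le> j" "j < 4 * r" for i j
  proof -
    have c2: "[a = b] (mod 2 * r)" if "[a = b] (mod 4 * r)" for a b
      using that by (rule cong_dvd_modulus_nat) simp
    have sh: "[walk (i + 2 * r) = walk i] (mod 2 * r)" for i
      using c2[OF walk_shift_cong[of i]] by (simp add: cong_def)
    consider "j < 2 * r" | "i < 2 * r" "2 * r \<le> j" | "2 * r \<le> i" by linarith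
    then show ?thesis
    proof cases
      case 1
      then show ?thesis using inj2[OF c2[OF that(1)]] that by simp
    next
      case 2
      then obtain l where l: "j = l + 2 * r" by (metis le_add_diff_inverse2)
      have "l < 2 * r" using that(3) l by simp
      then have "i = l"
        using inj2[of i l] cong_trans[OF c2[OF that(1)[unfolded l]] sh] 2(1) by blast
      \<comment> \<open>Indices in different turns would make the shift \<open>2 * r\<close> vanish
        modulo \<open>4 * r\<close>.\<close>
      then have "[walk i + 0 = walk i + 2 * r] (mod 4 * r)"
        using cong_trans[OF that(1)[unfolded l] walk_shift_cong[of l]] by simp
      then have "[0 = 2 * r] (mod 4 * r)"
        by (simp only: cong_add_lcancel_nat)
      then show ?thesis using r_pos by (simp add: cong_def)
    next
      case 3
      then obtain l m where l: "i = m + 2 * r" "j = l + 2 * r"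
        using \<open>i \<le> j\<close> by (metis le_add_diff_inverse2 le_trans)
      have "[walk m = walk l] (mod 2 * r)"
        using c2[OF that(1)] sh[of l] sh[of m] unfolding l by (metis cong_def)
      then show ?thesis
        using inj2[of m l] that unfolding l by simp
    qed
  qed
  show ?thesis
    by (rule inj_onI) (metis * cong_def lessThan_iff nat_le_linear)
qed

text \<open>The residue \<open>x0\<close> recurs only after a full turn, so its predecessor
  \<open>z\<close> has index \<open>2 * r - 1\<close> in the first turn and \<open>4 * r - 1\<close>
  in the second.\<close>

lemma walk_last: "walk (4 * r - 1) mod (2 * r) = z"
proof -
  have "z \<in> (\<lambda>j. walk j mod (2 * r)) ` {..<2 * r}"
    using bij_betw_imp_surj_on[OF walk_bij] z(1) by simp
  then obtain j where j: "j < 2 * r" "walk j mod (2 * r) = z"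
    by blast
  have "walk (Suc j) mod (2 * r) =
      (walk j mod (2 * r) + st (walk j mod (2 * r))) mod (2 * r)"
    by (simp only: walk.simps mod_add_left_eq)
  also have "\<dots> = walk 0 mod (2 * r)"
    using x0 by (simp only: j(2) z(2,3) walk.simps mod_less)
  finally have "walk (Suc j) mod (2 * r) = walk 0 mod (2 * r)" .
  from inj_onD[OF bij_betw_imp_inj_on[OF walk_bij] this] have "\<not> Suc j < 2 * r"
    using r_pos by auto
  then have "4 * r - 1 = j + 2 * r"
    using j(1) by linarith
  moreover have "[walk (j + 2 * r) = walk j + 2 * r] (mod 2 * r)"
    using walk_shift_cong by (rule cong_dvd_modulus_nat) simp
  ultimately show ?thesis
    using j(2) by (simp add: cong_def)
qed

text \<open>The \<open>j\<close>-th arc of the \<open>i\<close>-th translate; \<open>j = 4r - 1\<close> gives the removed arcs.\<close>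

definition walk_arc :: "nat \<times> nat \<Rightarrow> nat \<times> nat" where
  "walk_arc = (\<lambda>(i, j). ((walk j + 2 * i) mod (4 * r), (walk (Suc j) + 2 * i) mod (4 * r)))"

section \<open>The translates of the cycle use every arc exactly once\<close>

lemma walk_arc_conv:
  "walk_arc (i, j) = ((walk j + 2 * i) mod (4 * r),
     ((walk j + 2 * i) mod (4 * r) + st (walk j mod (2 * r))) mod (4 * r))"
  unfolding walk_arc_def prod.case walk.simps mod_add_left_eq by (simp only: add_ac)

lemma walk_mod_less: "walk j mod (2 * r) < 2 * r"
  using r_pos by simp

lemma walk_arc_in_arcs: "walk_arc e \<in> arcs (C4 r)"
proof (cases e)
  case (Pair i j)
  let ?u = "(walk j + 2 * i) mod (4 * r)" and ?s = "st (walk j mod (2 * r))"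
  have "walk_arc e = (?u, (?u + ?s) mod (4 * r))"
    unfolding Pair by (rule walk_arc_conv)
  moreover have "?u \<in> {0..<4 * r}" "?s \<in> {1..r}"
    using r_pos st_ge[OF walk_mod_less] st_le[OF walk_mod_less] by simp_all
  ultimately show ?thesis
    unfolding C4_def cayley_cyclic_def pre_digraph.select_convs by blast
qed

text \<open>An arc determines its step and the parity of its tail. Translations are even, so parity
  and step fix the walk's residue modulo \<open>2 * r\<close>; the tail then gives \<open>i\<close>,
  and \<open>walk_inj\<close> gives \<open>j\<close>.\<close>

lemma walk_arc_inj: "inj_on walk_arc ({..<r} \<times> {..<4 * r})"
proof (rule inj_onI, clarify)
  fix i j i' j' assume less: "i < r" "j < 4 * r" "i' < r" "j' < 4 * r"
    and eq: "walk_arc (i, j) = walk_arc (i', j')"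
  define s s' where "s = st (walk j mod (2 * r))" and "s' = st (walk j' mod (2 * r))"
  have "s < 4 * r" "s' < 4 * r"
    using st_le[OF walk_mod_less[of j]] st_le[OF walk_mod_less[of j']] r_pos
    by (simp_all add: s_def s'_def)
  have eq1: "(walk j + 2 * i) mod (4 * r) = (walk j' + 2 * i') mod (4 * r)"
    and eq2: "((walk j + 2 * i) mod (4 * r) + s) mod (4 * r) =
      ((walk j' + 2 * i') mod (4 * r) + s') mod (4 * r)"
    using eq unfolding walk_arc_conv prod.inject s_def s'_def by blast+
  have u: "[walk j + 2 * i = walk j' + 2 * i'] (mod 4 * r)"
    unfolding cong_def by (fact eq1)
  have "[(walk j' + 2 * i') mod (4 * r) + s = (walk j' + 2 * i') mod (4 * r) + s'] (mod 4 * r)"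
    using eq2 unfolding eq1 cong_def .
  then have s_eq: "s = s'"
    using \<open>s < 4 * r\<close> \<open>s' < 4 * r\<close>
    by (simp only: cong_add_lcancel_nat) (simp add: cong_def)
  have parity: "walk j mod (2 * r) mod 2 = walk j' mod (2 * r) mod 2"
  proof -
    have "[walk j + 2 * i = walk j' + 2 * i'] (mod 2)"
      using u by (rule cong_dvd_modulus_nat) simp
    then have "walk j mod 2 = walk j' mod 2"
      by (simp add: cong_def)
    then show ?thesis
      by (simp only: mod_mod_cancel dvd_triv_left)
  qed
  have w: "[walk j = walk j'] (mod 2 * r)"
    using st_inj[OF walk_mod_less walk_mod_less parity s_eq[unfolded s_def s'_def]]
    unfolding cong_def .
  have "[walk j + 2 * i = walk j' + 2 * i'] (mod 2 * r)"
    using u by (rule cong_dvd_modulus_nat) simp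
  with cong_sym[OF cong_add[OF w cong_refl]]
  have "[walk j' + 2 * i = walk j' + 2 * i'] (mod 2 * r)"
    by (rule cong_trans)
  then have "[2 * i = 2 * i'] (mod 2 * r)"
    by (simp only: cong_add_lcancel_nat)
  then have "i = i'"
    using less by (simp add: cong_def)
  with u have "[walk j = walk j'] (mod 4 * r)"
    by (simp only: cong_add_rcancel_nat)
  from inj_onD[OF walk_inj this[unfolded cong_def]] have "j = j'"
    using less by simp
  with \<open>i = i'\<close> show "i = i' \<and> j = j'" by blast
qed

lemma walk_arc_image: "walk_arc ` ({..<r} \<times> {..<4 * r}) = arcs (C4 r)"
proof (rule card_seteq[OF C4_finite])
  show "card (arcs (C4 r)) \<le> card (walk_arc ` ({..<r} \<times> {..<4 * r}))"
    using card_arcs_C4_le[of r] unfolding card_image[OF walk_arc_inj] card_cartesian_product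
    by (simp add: mult.left_commute mult.commute)
qed (use walk_arc_in_arcs in blast)

lemma card_arcs: "card (arcs (C4 r)) = 4 * r * r"
  using card_image[OF walk_arc_inj] unfolding walk_arc_image card_cartesian_product by simp

section \<open>Upper and lower bound for the path number\<close>

lemma path_decomposition_le: "\<exists>P. path_decomposition (C4 r) P \<and> card P = r + 1"
proof -
  define Q where
    "Q = insert ({..<r} \<times> {4 * r - 1}) ((\<lambda>i. {i} \<times> {..<4 * r - 1}) ` {..<r})"
  have less: "0 < 4 * r - 1" "Suc (4 * r - 1) = 4 * r"
    using r_pos by simp_all
  have part: "partition_on ({..<r} \<times> {..<4 * r}) Q"
    using partition_on_rows_and_last_column[OF r_pos less(1)] by (simp only: Q_def less(2))
  have "card Q = r + 1"
    using card_rows_and_last_column[OF r_pos less(1)] by (simp only: Q_def)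
  moreover have "inj_on ((`) walk_arc) Q"
  proof (rule inj_on_subset[OF inj_on_image_Pow[OF walk_arc_inj]])
    show "Q \<subseteq> Pow ({..<r} \<times> {..<4 * r})"
      using partition_onD1[OF part] by blast
  qed
  ultimately have "card ((`) walk_arc ` Q) = r + 1"
    by (simp add: card_image)
  moreover have "path_decomposition (C4 r) ((`) walk_arc ` Q)"
    unfolding path_decomposition_def
  proof (intro conjI ballI)
    show "finite ((`) walk_arc ` Q)" by (simp add: Q_def)
    have "{} \<notin> (`) walk_arc ` Q"
      using part by (auto simp: partition_on_def)
    then show "partition_on (arcs (C4 r)) ((`) walk_arc ` Q)"
      using partition_on_inj_image[OF part walk_arc_inj] by (simp add: walk_arc_image)
  next
    have verts: "verts (C4 r) = {0..<4 * r}" and [simp]: "tail (C4 r) = fst" "head (C4 r) = snd"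
      by (simp_all add: C4_def cayley_cyclic_def)
    fix A assume "A \<in> (`) walk_arc ` Q"
    then consider i where "i < r" "A = walk_arc ` ({i} \<times> {..<4 * r - 1})"
      | "A = walk_arc ` ({..<r} \<times> {4 * r - 1})"
      by (auto simp: Q_def)
    then show "\<exists>u p v. pre_digraph.apath (C4 r) u p v \<and> A = set p"
    proof cases
      case 1
      let ?f = "\<lambda>j. (walk j + 2 * i) mod (4 * r)"
      have "inj_on ?f {..4 * r - 1}"
      proof (rule inj_onI)
        fix j l assume jl: "j \<in> {..4 * r - 1}" "l \<in> {..4 * r - 1}" "?f j = ?f l"
        then have "[walk j + 2 * i = walk l + 2 * i] (mod 4 * r)" by (simp add: cong_def)
        then have "[walk j = walk l] (mod 4 * r)" by (simp only: cong_add_rcancel_nat)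
        moreover have "j < 4 * r" "l < 4 * r" using jl r_pos by auto
        ultimately show "j = l" using inj_onD[OF walk_inj, of j l] by (simp add: cong_def)
      qed
      then have "pre_digraph.apath (C4 r) (?f 0) (map (\<lambda>j. walk_arc (i, j)) [0..<4 * r - 1]) (?f (4 * r - 1))"
        using r_pos
        by (intro pre_digraph.apath_map_upt walk_arc_in_arcs) (simp_all add: verts walk_arc_def)
      moreover have "A = set (map (\<lambda>j. walk_arc (i, j)) [0..<4 * r - 1])"
        using 1(2) by auto
      ultimately show ?thesis by blast
    next
      case 2
      let ?w = "walk (4 * r - 1)"
      let ?f = "\<lambda>i. (?w + 2 * i) mod (4 * r)"
      \<comment> \<open>The total advance \<open>2 * r\<close> is below the modulus, so the path of
        removed arcs does not close up.\<close>
      have "inj_on ?f {..r}"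
      proof (rule inj_onI)
        fix j l assume jl: "j \<in> {..r}" "l \<in> {..r}" "?f j = ?f l"
        then have "[?w + 2 * j = ?w + 2 * l] (mod 4 * r)" by (simp add: cong_def)
        then have "[2 * j = 2 * l] (mod 4 * r)" by (simp only: cong_add_lcancel_nat)
        then show "j = l" using jl r_pos by (simp add: cong_def)
      qed
      \<comment> \<open>The step at \<open>z\<close> is 2, so the head in translate \<open>i\<close>
        is the tail in translate \<open>i + 1\<close>.\<close>
      moreover have "walk_arc (i, 4 * r - 1) = (?f i, ?f (Suc i))" for i
        unfolding walk_arc_def prod.case walk.simps walk_last z(2) by (simp add: add_ac)
      ultimately have "pre_digraph.apath (C4 r) (?f 0) (map (\<lambda>i. walk_arc (i, 4 * r - 1)) [0..<r]) (?f r)"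
        using r_pos
        by (intro pre_digraph.apath_map_upt walk_arc_in_arcs) (simp_all add: verts)
      moreover have "A = set (map (\<lambda>i. walk_arc (i, 4 * r - 1)) [0..<r])"
        using 2 by auto
      ultimately show ?thesis by blast
    qed
  qed
  ultimately show ?thesis by blast
qed

lemma path_decomposition_ge:
  assumes "path_decomposition (C4 r) P"
  shows "r + 1 \<le> card P"
proof -
  interpret loopfree_digraph "C4 r" by (rule C4_loopfree)
  have part: "partition_on (arcs (C4 r)) P"
    using assms by (simp add: path_decomposition_def)
  have verts: "verts (C4 r) = {0..<4 * r}"
    by (simp add: C4_def cayley_cyclic_def)
  have le: "card A \<le> 4 * r - 1" if "A \<in> P" for A
    using assms that card_apath_less verts unfolding path_decomposition_def by fastforce
  have "4 * r * r = card (\<Union>P)"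
    using part card_arcs by (simp add: partition_on_def)
  also have "\<dots> = (\<Sum>A\<in>P. card A)"
    using part C4_finite[of r]
    by (intro card_Union_disjoint)
      (auto simp: partition_on_def disjoint_def pairwise_def disjnt_def
        intro: finite_subset)
  also have "\<dots> \<le> card P * (4 * r - 1)"
    using sum_bounded_above[of P card "4 * r - 1"] le by simp
  finally have *: "4 * r * r \<le> card P * (4 * r - 1)" .
  show ?thesis
  proof (rule ccontr)
    assume "\<not> ?thesis"
    then have "card P * (4 * r - 1) \<le> r * (4 * r - 1)"
      by (intro mult_right_mono) simp_all
    also have "\<dots> < r * (4 * r)"
      using r_pos by simp
    finally show False using * by (simp add: ac_simps)
  qed
qed

lemma path_number_C4: "path_number (C4 r) = r + 1"
  unfolding path_number_def
proof (rule Least_equality, rule path_decomposition_le)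
  show "r + 1 \<le> n" if "\<exists>P. path_decomposition (C4 r) P \<and> card P = n" for n
    using that path_decomposition_ge by blast
qed

end

section \<open>A cyclic step function\<close>

text \<open>
  The steps for \<open>r = 4k + 1\<close>.  On an interval where the step is \<open>c - 2x\<close>, the map \<open>x \<mapsto> x + s(x)\<close> is the
  reflection \<open>x \<mapsto> c - x\<close>; roughly, every quarter of the residues modulo \<open>2r\<close> is reflected onto the next
  one, so that four steps are a translation by 2 or -2.  The cycle consists of the blocks
  \<open>2t, 4k - 2 - 2t, 4k + 3 + 2t, 8k + 1 - 2t\<close> for \<open>t < k\<close>, then \<open>2k + 1\<close>, the blocks
  \<open>6k + 2 + 2t, 2k - 1 - 2t, 2k + 3 + 2t, 6k - 2t\<close> for \<open>t < k - 1\<close>, and finally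
  \<open>8k, 1, 4k, 4k + 1, 4k + 2\<close>.
\<close>

definition zigzag_step :: "nat \<Rightarrow> nat \<Rightarrow> nat" where
  "zigzag_step k x =
     (if even x then
        if x < 2 * k then 4 * k - 2 - 2 * x
        else if x \<le> 4 * k then 8 * k + 1 - 2 * x
        else if x \<le> 6 * k then 12 * k + 4 - 2 * x
        else 16 * k + 3 - 2 * x
      else
        if x = 1 then 4 * k - 1
        else if x = 6 * k + 3 then 4 * k
        else if x < 2 * k then 4 * k + 2 - 2 * x
        else if x \<le> 4 * k + 1 then 8 * k + 3 - 2 * x
        else if x \<le> 6 * k + 1 then 12 * k + 4 - 2 * x
        else 16 * k + 5 - 2 * x)"

text \<open>The four branches use different classes modulo 4, and within a branch the step falls by
  4 as \<open>a\<close> grows, so no step repeats. The equations avoid truncated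
  subtraction.\<close>

lemma zigzag_step_double:
  assumes "a \<le> 4 * k"
  shows "a < k \<and> zigzag_step k (2 * a) + 4 * a + 2 = 4 * k \<and> zigzag_step k (2 * a) mod 4 = 2 \<or>
    k \<le> a \<and> a \<le> 2 * k \<and> zigzag_step k (2 * a) + 4 * a = 8 * k + 1 \<and> zigzag_step k (2 * a) mod 4 = 1 \<or>
    2 * k < a \<and> a \<le> 3 * k \<and> zigzag_step k (2 * a) + 4 * a = 12 * k + 4 \<and> zigzag_step k (2 * a) mod 4 = 0 \<or>
    3 * k < a \<and> a \<le> 4 * k \<and> zigzag_step k (2 * a) + 4 * a = 16 * k + 3 \<and> zigzag_step k (2 * a) mod 4 = 3"
proof -
  consider "a < k" | "k \<le> a" "a \<le> 2 * k" | "2 * k < a" "a \<le> 3 * k" | "3 * k < a"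
    by linarith
  then show ?thesis
  proof cases
    case 1
    then have "zigzag_step k (2 * a) + 4 * a + 2 = 4 * k" by (simp add: zigzag_step_def)
    moreover from this have "zigzag_step k (2 * a) mod 4 = 2" by presburger
    ultimately show ?thesis using 1 by blast
  next
    case 2
    then have "zigzag_step k (2 * a) + 4 * a = 8 * k + 1" by (simp add: zigzag_step_def)
    moreover from this have "zigzag_step k (2 * a) mod 4 = 1" by presburger
    ultimately show ?thesis using 2 by blast
  next
    case 3
    then have "zigzag_step k (2 * a) + 4 * a = 12 * k + 4" by (simp add: zigzag_step_def)
    moreover from this have "zigzag_step k (2 * a) mod 4 = 0" by presburger
    ultimately show ?thesis using 3 by blast
  next
    case 4
    then have "zigzag_step k (2 * a) + 4 * a = 16 * k + 3" using assms by (simp add: zigzag_step_def)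
    moreover from this have "zigzag_step k (2 * a) mod 4 = 3" by presburger
    ultimately show ?thesis using 4 assms by blast
  qed
qed

text \<open>At 1 and \<open>6 * k + 3\<close> the values \<open>4 * k\<close> and
  \<open>4 * k - 1\<close> of the general branches are interchanged, which leaves the set of
  odd-residue steps unchanged. Without this, 1 and \<open>4 * k\<close> would both move to
  \<open>4 * k + 1\<close>.\<close>

lemma zigzag_step_double_plus_one:
  assumes "a \<le> 4 * k" "1 \<le> k"
  defines "s \<equiv> zigzag_step k (2 * a + 1)"
  shows "a = 0 \<and> s + 1 = 4 * k \<and> s mod 4 = 3 \<or>
    1 \<le> a \<and> a < k \<and> s + 4 * a = 4 * k \<and> s mod 4 = 0 \<or>
    k \<le> a \<and> a \<le> 2 * k \<and> s + 4 * a = 8 * k + 1 \<and> s mod 4 = 1 \<or>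
    2 * k < a \<and> a \<le> 3 * k \<and> s + 4 * a = 12 * k + 2 \<and> s mod 4 = 2 \<or>
    a = 3 * k + 1 \<and> s = 4 * k \<and> s mod 4 = 0 \<or>
    3 * k + 1 < a \<and> a \<le> 4 * k \<and> s + 4 * a = 16 * k + 3 \<and> s mod 4 = 3"
proof -
  consider "a = 0" | "1 \<le> a" "a < k" | "k \<le> a" "a \<le> 2 * k" | "2 * k < a" "a \<le> 3 * k"
    | "a = 3 * k + 1" | "3 * k + 1 < a"
    by linarith
  then show ?thesis
  proof cases
    case 1
    then have "s + 1 = 4 * k" using assms(2) by (simp add: s_def zigzag_step_def)
    moreover from this have "s mod 4 = 3" by presburger
    ultimately show ?thesis using 1 by blast
  next
    case 2
    then have "s + 4 * a = 4 * k" by (simp add: s_def zigzag_step_def)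
    moreover from this have "s mod 4 = 0" by presburger
    ultimately show ?thesis using 2 by blast
  next
    case 3
    then have "s + 4 * a = 8 * k + 1" using assms(2) by (simp add: s_def zigzag_step_def)
    moreover from this have "s mod 4 = 1" by presburger
    ultimately show ?thesis using 3 by blast
  next
    case 4
    then have "s + 4 * a = 12 * k + 2" using assms(2) by (simp add: s_def zigzag_step_def)
    moreover from this have "s mod 4 = 2" by presburger
    ultimately show ?thesis using 4 by blast
  next
    case 5
    then have "s = 4 * k" using assms(2) by (simp add: s_def zigzag_step_def)
    then show ?thesis using 5 by simp
  next
    case 6
    then have "s + 4 * a = 16 * k + 3" using assms(1,2) by (simp add: s_def zigzag_step_def)
    moreover from this have "s mod 4 = 3" by presburger
    ultimately show ?thesis using 6 assms(1) by blast
  qed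
qed

lemma zigzag_step_range:
  assumes "k \<ge> 1" "x < 8 * k + 2"
  shows "1 \<le> zigzag_step k x" "zigzag_step k x \<le> 4 * k + 1"
proof -
  have "1 \<le> zigzag_step k x \<and> zigzag_step k x \<le> 4 * k + 1"
  proof (cases "even x")
    case True
    then obtain a where a: "x = 2 * a" by (elim evenE)
    then have "a \<le> 4 * k" using assms by simp
    from zigzag_step_double[OF this] show ?thesis
      unfolding a using assms(1) by (elim disjE) linarith+
  next
    case False
    then obtain a where a: "x = 2 * a + 1" by (elim oddE)
    then have "a \<le> 4 * k" using assms by simp
    from zigzag_step_double_plus_one[OF this assms(1)] show ?thesis
      unfolding a using assms(1) by (elim disjE) linarith+
  qed
  then show "1 \<le> zigzag_step k x" "zigzag_step k x \<le> 4 * k + 1" by blast+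
qed

lemma zigzag_step_inj:
  assumes "k \<ge> 1" "x < 8 * k + 2" "y < 8 * k + 2" "x mod 2 = y mod 2" "zigzag_step k x = zigzag_step k y"
  shows "x = y"
proof (cases "even x")
  case True
  then obtain a b where ab: "x = 2 * a" "y = 2 * b"
    using assms(4) by (metis dvd_eq_mod_eq_0 evenE)
  then have "a \<le> 4 * k" "b \<le> 4 * k" using assms(2,3) by simp_all
  from this[THEN zigzag_step_double] have "a = b"
    using assms(5) unfolding ab by (elim disjE; simp)
  then show ?thesis by (simp add: ab)
next
  case False
  then obtain a b where ab: "x = 2 * a + 1" "y = 2 * b + 1"
    using assms(4) by (metis oddE odd_iff_mod_2_eq_one)
  then have "a \<le> 4 * k" "b \<le> 4 * k" using assms(2,3) by simp_all
  \<comment> \<open>Classes 0 and 3 modulo 4 each contain two branches; the exceptional one has the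
    larger value, \<open>4 * k\<close> or \<open>4 * k - 1\<close>.\<close>
  from this[THEN zigzag_step_double_plus_one, OF assms(1)] have "a = b"
    using assms(5) unfolding ab by (elim disjE; simp)
  then show ?thesis by (simp add: ab)
qed

text \<open>The traversal enters the last block of the first kind at \<open>2 * k\<close>, follows
  the second kind (\<open>up\<close>), the closing five residues and the first kind
  (\<open>down\<close>), and then every residue is located on it.\<close>

lemma zigzag_step_orbit:
  assumes "k \<ge> 1" "x < 8 * k + 2"
  shows "x \<in> range (\<lambda>j. ((\<lambda>x. (x + zigzag_step k x) mod (8 * k + 2)) ^^ j) (2 * k))"
proof -
  let ?f = "\<lambda>x. (x + zigzag_step k x) mod (8 * k + 2)"
  define R where "R = range (\<lambda>j. (?f ^^ j) (2 * k))"
  have R0: "2 * k \<in> R"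
    unfolding R_def by (rule range_eqI[of _ _ 0]) simp
  have R1: "y \<in> R" if "x \<in> R" "?f x = y" for x y
  proof -
    obtain j where "x = (?f ^^ j) (2 * k)"
      using \<open>x \<in> R\<close> by (auto simp: R_def)
    then have "y = (?f ^^ Suc j) (2 * k)"
      using that(2) by simp
    then show ?thesis unfolding R_def by blast
  qed
  \<comment> \<open>A step wraps around at most once; adding the modulus to \<open>y\<close> in
    \<open>step_ge\<close> avoids subtraction.\<close>
  have step_lt: "y \<in> R" if "x \<in> R" "x + zigzag_step k x = y" "y < 8 * k + 2" for x y
    using R1[OF that(1)] that by simp
  have step_ge: "y \<in> R" if "x \<in> R" "x + zigzag_step k x = y + (8 * k + 2)" "y < 8 * k + 2" for x y
    by (rule R1[OF that(1)]) (simp only: that(2,3) mod_add_self2 mod_less)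
  have a1: "6 * k + 1 \<in> R"
    by (rule step_lt[OF R0]) (use assms in \<open>auto simp: zigzag_step_def\<close>)
  have a2: "6 * k + 3 \<in> R"
    by (rule step_lt[OF a1]) (use assms in \<open>auto simp: zigzag_step_def\<close>)
  have a3: "2 * k + 1 \<in> R"
    by (rule step_ge[OF a2]) (use assms in \<open>auto simp: zigzag_step_def\<close>)
  have a4: "6 * k + 2 \<in> R"
    by (rule step_lt[OF a3]) (use assms in \<open>auto simp: zigzag_step_def\<close>)
  \<comment> \<open>The bound \<open>t + 1 < k\<close> keeps \<open>2 * k - 1 - 2 * t\<close> off
    the exceptional residue 1, which is entered from \<open>8 * k\<close>, the case
    \<open>t = k - 1\<close> of \<open>b1\<close>.\<close>
  have up: "2 * k - 1 - 2 * t \<in> R \<and> 2 * k + 3 + 2 * t \<in> R \<and> 6 * k - 2 * t \<in> R \<and>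
      6 * k + 2 + 2 * Suc t \<in> R"
    if "6 * k + 2 + 2 * t \<in> R" "t + 1 < k" for t
  proof -
    have 1: "2 * k - 1 - 2 * t \<in> R"
      by (rule step_ge[OF that(1)]) (use that(2) in \<open>auto simp: zigzag_step_def\<close>)
    have 2: "2 * k + 3 + 2 * t \<in> R"
      by (rule step_lt[OF 1]) (use that(2) in \<open>auto simp: zigzag_step_def\<close>)
    have 3: "6 * k - 2 * t \<in> R"
      by (rule step_lt[OF 2]) (use that(2) in \<open>auto simp: zigzag_step_def\<close>)
    have 4: "6 * k + 2 + 2 * Suc t \<in> R"
      by (rule step_lt[OF 3]) (use that(2) in \<open>auto simp: zigzag_step_def\<close>)
    show ?thesis using 1 2 3 4 by blast
  qed
  have b1: "6 * k + 2 + 2 * t \<in> R" if "t < k" for t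
    using that by (induction t) (use a4 up in auto)
  obtain k' where "k = Suc k'"
    using assms(1) by (cases k) auto
  then have b2: "8 * k \<in> R"
    using b1[of k'] by (simp add: algebra_simps)
  have b3: "1 \<in> R"
    by (rule step_ge[OF b2]) (use assms in \<open>auto simp: zigzag_step_def\<close>)
  have b4: "4 * k \<in> R"
    by (rule step_lt[OF b3]) (use assms in \<open>auto simp: zigzag_step_def\<close>)
  have b5: "4 * k + 1 \<in> R"
    by (rule step_lt[OF b4]) (use assms in \<open>auto simp: zigzag_step_def\<close>)
  have b6: "4 * k + 2 \<in> R"
    by (rule step_lt[OF b5]) (use assms in \<open>auto simp: zigzag_step_def\<close>)
  have b7: "0 \<in> R"
    by (rule step_ge[OF b6]) (use assms in \<open>auto simp: zigzag_step_def\<close>)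
  \<comment> \<open>For \<open>t = k - 1\<close> the block ends in the exceptional residue
    \<open>6 * k + 3\<close>, which leads to \<open>2 * k + 1\<close> instead of a further
    block.\<close>
  have down: "4 * k - 2 - 2 * t \<in> R \<and> 4 * k + 3 + 2 * t \<in> R \<and> 8 * k + 1 - 2 * t \<in> R \<and>
      (Suc t < k \<longrightarrow> 2 * Suc t \<in> R)"
    if "2 * t \<in> R" "t < k" for t
  proof -
    have 1: "4 * k - 2 - 2 * t \<in> R"
      by (rule step_lt[OF that(1)]) (use that(2) in \<open>auto simp: zigzag_step_def\<close>)
    have 2: "4 * k + 3 + 2 * t \<in> R"
      by (rule step_lt[OF 1]) (use that(2) in \<open>auto simp: zigzag_step_def\<close>)
    have 3: "8 * k + 1 - 2 * t \<in> R"
      by (rule step_lt[OF 2]) (use that(2) in \<open>auto simp: zigzag_step_def\<close>)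
    have 4: "2 * Suc t \<in> R" if "Suc t < k"
      by (rule step_ge[OF 3]) (use that in \<open>auto simp: zigzag_step_def\<close>)
    show ?thesis using 1 2 3 4 by blast
  qed
  have c1: "2 * t \<in> R" if "t < k" for t
    using that by (induction t) (use b7 down in auto)
  have "x \<in> R"
  proof (cases "even x")
    case True
    then obtain a where a: "x = 2 * a" by (elim evenE)
    \<comment> \<open>Each interval of even residues is one position of the blocks; solving for
      \<open>t\<close> gives the block index.\<close>
    consider "a < k" | t where "t < k" "x = 4 * k - 2 - 2 * t" | "a = 2 * k" | "a = 2 * k + 1"
      | t where "t + 1 < k" "x = 6 * k - 2 * t" | t where "t < k" "x = 6 * k + 2 + 2 * t"
    proof -
      consider "a < k" | "k \<le> a" "a < 2 * k" | "a = 2 * k" | "a = 2 * k + 1"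
        | "2 * k + 1 < a" "a \<le> 3 * k" | "3 * k < a" "a \<le> 4 * k"
        using assms a by linarith
      then show thesis
      proof cases
        case 2
        then show thesis using that(2)[of "2 * k - 1 - a"] a by linarith
      next
        case 5
        then show thesis using that(5)[of "3 * k - a"] a by linarith
      next
        case 6
        then show thesis using that(6)[of "a - 3 * k - 1"] a by linarith
      qed (fact that)+
    qed
    then show ?thesis
      by cases (use a b1 b4 b6 c1 up[OF b1] down[OF c1] in auto)
  next
    case False
    then obtain a where a: "x = 2 * a + 1" by (elim oddE)
    consider "a = 0" | t where "t + 1 < k" "x = 2 * k - 1 - 2 * t" | "a = k"
      | t where "t + 1 < k" "x = 2 * k + 3 + 2 * t" | "a = 2 * k"
      | t where "t < k" "x = 4 * k + 3 + 2 * t" | t where "t < k" "x = 8 * k + 1 - 2 * t"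
    proof -
      consider "a = 0" | "1 \<le> a" "a < k" | "a = k" | "k < a" "a < 2 * k" | "a = 2 * k"
        | "2 * k < a" "a \<le> 3 * k" | "3 * k < a" "a \<le> 4 * k"
        using assms a by linarith
      then show thesis
      proof cases
        case 2
        then show thesis using that(2)[of "k - 1 - a"] a by linarith
      next
        case 4
        then show thesis using that(4)[of "a - k - 1"] a by linarith
      next
        case 6
        then show thesis using that(6)[of "a - 2 * k - 1"] a by linarith
      next
        case 7
        then show thesis using that(7)[of "4 * k - a"] a by linarith
      qed (fact that)+
    qed
    then show ?thesis
      by cases (use a b3 a3 b5 up[OF b1] down[OF c1] in \<open>auto simp: numeral_3_eq_3\<close>)
  qed
  then show ?thesis unfolding R_def .
qed

theorem theorem5p5:
  fixes r :: nat
  assumes "r mod 4 = 1" and "r \<ge> 9"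
  shows "path_number (C4 r) = r + 1"
proof -
  obtain k where k: "r = 4 * k + 1"
    using assms(1) by (metis mult_div_mod_eq)
  have "k \<ge> 1" using assms(2) k by simp
  have r2: "2 * r = 8 * k + 2" by (simp add: k)
  \<comment> \<open>The step at \<open>z = 2 * k - 2\<close> is
    \<open>4 * k - 2 - 2 * z = 2\<close>, which leads to \<open>x0 = 2 * k\<close>.\<close>
  interpret cyclic_step r "zigzag_step k" "2 * k" "2 * k - 2"
  proof
    fix x y
    assume x: "x < 2 * r"
    show "1 \<le> zigzag_step k x" "zigzag_step k x \<le> r"
      using zigzag_step_range[OF \<open>k \<ge> 1\<close>, of x] x unfolding r2 k by simp_all
    show "x \<in> range (\<lambda>j. ((\<lambda>x. (x + zigzag_step k x) mod (2 * r)) ^^ j) (2 * k))"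
      using zigzag_step_orbit[OF \<open>k \<ge> 1\<close>] x unfolding r2 .
    assume "y < 2 * r" "x mod 2 = y mod 2" "zigzag_step k x = zigzag_step k y"
    with x show "x = y"
      unfolding r2 by (rule zigzag_step_inj[OF \<open>k \<ge> 1\<close>])
  qed (use assms(1) \<open>k \<ge> 1\<close> in \<open>auto simp: k zigzag_step_def\<close>)
  show ?thesis by (rule path_number_C4)
qed

end
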